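(* Let $M$ be a positive integer and let $A,B\subset\mathbb{Z}$ be such that the elements of $A$ are distinct modulo $M$ and the elements of $B$ are distinct modulo $M$. Define \[ D_A=\{(a-a',M):\ a,a'\in A,\ a\neq a'\},\qquad D_B=\{(b-b',M):\ b,b'\in B,\ b\neq b'\}. \] If $D_A\cap D_B=\emptyset$, then $|A|\,|B|\le M$, and equality $|A|\,|B|=M$ holds if and only if $A\oplus B=\mathbb{Z}/M\mathbb{Z}$.
   Context: $(m,n)$ denotes the greatest common divisor of $m$ and $n$. $A\oplus B=\mathbb{Z}/M\mathbb{Z}$ means that $|A|\,|B|=M$ and every integer $n$ can be written in a unique way as $n=a+c$ with $a\in A$ and $c\in B+M\mathbb{Z}$. *)

theory Defs
  imports Main
begin

text \<open>The set \<open>D\<^sub>A\<close> (relative to \<open>M\<close>); \<open>gcd\<close> on \<open>int\<close> is nonnegative.\<close>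

definition gcd_differences :: "nat \<Rightarrow> int set \<Rightarrow> int set" where
  "gcd_differences M A = {gcd (a - a') (int M) | a a'. a \<in> A \<and> a' \<in> A \<and> a \<noteq> a'}"

text \<open>The set \<open>B + M\<int>\<close>.\<close>

definition periodic_extension :: "nat \<Rightarrow> int set \<Rightarrow> int set" where
  "periodic_extension M B = {b + int M * k | b k. b \<in> B}"

text \<open>\<open>A \<oplus> B = \<int>/M\<int>\<close>. Uniqueness is that of the pair \<open>(a, c)\<close> with \<open>a \<in> A\<close> and \<open>c \<in> B + M\<int>\<close>.
  For \<open>M > 0\<close> the cardinality condition forces \<open>A\<close> and \<open>B\<close> to be finite, since \<open>card\<close> of an
  infinite set is \<open>0\<close>.\<close>

definition tiles_cyclic :: "nat \<Rightarrow> int set \<Rightarrow> int set \<Rightarrow> bool" where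
  "tiles_cyclic M A B \<longleftrightarrow>
     card A * card B = M \<and>
     (\<forall>n::int. \<exists>!p. p \<in> A \<times> periodic_extension M B \<and> n = fst p + snd p)"

end

theory Submission
  imports Defs
begin

text \<open>
  The hypothesis makes addition modulo \<open>M\<close> injective on \<open>A \<times> B\<close>. Indeed, if
  \<open>a + b \<equiv> a' + b' (mod M)\<close>, then \<open>a - a' \<equiv> b' - b\<close>, so these two differences have the same
  greatest common divisor with \<open>M\<close>, and the sign of \<open>b' - b\<close> does not affect it. If \<open>a \<noteq> a'\<close>,
  then \<open>b \<noteq> b'\<close> as well, because distinct elements of \<open>A\<close> are incongruent, and symmetrically;
  so two different pairs with congruent sums would put the common gcd in both difference sets.
  There are \<open>M\<close> residues, so \<open>|A| |B| \<le> M\<close> by counting. When equality holds, an injection between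
  finite sets of the same size is onto: every residue is a sum, in exactly one way.
\<close>

text \<open>A coincidence of sums modulo \<open>M\<close> is a coincidence of differences modulo \<open>M\<close>, and congruent
  numbers have the same gcd with \<open>M\<close>. Disjointness thus makes one of the differences zero, and
  the injectivity of reduction on \<open>A\<close> or \<open>B\<close> makes the other one zero too.\<close>

lemma inj_on_sum_mod:
  fixes M :: nat and A B :: "int set"
  assumes injA: "inj_on (\<lambda>a. a mod int M) A"
    and injB: "inj_on (\<lambda>b. b mod int M) B"
    and disj: "gcd_differences M A \<inter> gcd_differences M B = {}"
  shows "inj_on (\<lambda>(a, b). (a + b) mod int M) (A \<times> B)"
proof -
  have "a = a' \<and> b = b'"
    if mem: "a \<in> A" "a' \<in> A" "b \<in> B" "b' \<in> B" and eq: "(a + b) mod int M = (a' + b') mod int M"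
    for a a' b b'
  proof -
    have "(a + b) - (a' + b') = (a - a') - (b' - b)" by simp
    hence dvd: "int M dvd (a - a') - (b' - b)"
      using eq by (metis mod_eq_dvd_iff)
    hence "(a - a') mod int M = (b' - b) mod int M"
      by (simp only: mod_eq_dvd_iff)
    hence "gcd (a - a') (int M) = gcd (b' - b) (int M)"
      by (metis gcd_red_int)
    hence "gcd (a - a') (int M) = gcd (b - b') (int M)"
      by (metis gcd_neg1_int minus_diff_eq)
    hence "a = a' \<or> b = b'"
      using disj mem unfolding gcd_differences_def by blast
    moreover have "b = b'" if "a = a'"
    proof -
      have "int M dvd b - b'"
        using dvd that by simp
      hence "b mod int M = b' mod int M"
        by (simp only: mod_eq_dvd_iff)
      thus ?thesis using inj_onD[OF injB, of b b'] mem by simp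
    qed
    moreover have "a = a'" if "b = b'"
    proof -
      have "int M dvd a - a'"
        using dvd that by simp
      hence "a mod int M = a' mod int M"
        by (simp only: mod_eq_dvd_iff)
      thus ?thesis using inj_onD[OF injA, of a a'] mem by simp
    qed
    ultimately show ?thesis by blast
  qed
  thus ?thesis by (force simp: inj_on_def)
qed

lemma tiles_cyclic_if_bij_betw:
  fixes M :: nat and A B :: "int set"
  assumes card: "card A * card B = M"
    and bij: "bij_betw (\<lambda>(a, b). (a + b) mod int M) (A \<times> B) {0..<int M}"
    and "M > 0"
  shows "tiles_cyclic M A B"
proof -
  let ?f = "\<lambda>(a, b). (a + b) mod int M"
  have inj: "inj_on ?f (A \<times> B)" and onto: "?f ` (A \<times> B) = {0..<int M}"
    using bij by (auto simp: bij_betw_def)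
  have "\<exists>!p. p \<in> A \<times> periodic_extension M B \<and> n = fst p + snd p" for n :: int
  proof (rule ex_ex1I)
    have "n mod int M \<in> ?f ` (A \<times> B)"
      using onto \<open>M > 0\<close> by simp
    then obtain a b where ab: "a \<in> A" "b \<in> B" "n mod int M = (a + b) mod int M"
      by auto
    then obtain k where "n - (a + b) = int M * k"
      by (auto simp: mod_eq_dvd_iff)
    hence "n - a = b + int M * k" by simp
    hence "n - a \<in> periodic_extension M B"
      using ab unfolding periodic_extension_def by blast
    thus "\<exists>p. p \<in> A \<times> periodic_extension M B \<and> n = fst p + snd p"
      using ab by (intro exI[of _ "(a, n - a)"]) simp
  next
    fix p q
    assume p: "p \<in> A \<times> periodic_extension M B \<and> n = fst p + snd p"
      and q: "q \<in> A \<times> periodic_extension M B \<and> n = fst q + snd q"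
    obtain b k where b: "b \<in> B" "snd p = b + int M * k"
      using p unfolding periodic_extension_def by fastforce
    obtain b' k' where b': "b' \<in> B" "snd q = b' + int M * k'"
      using q unfolding periodic_extension_def by fastforce
    have "(fst p + b) mod int M = n mod int M"
      using p b by (metis add.assoc mod_mult_self2)
    moreover have "(fst q + b') mod int M = n mod int M"
      using q b' by (metis add.assoc mod_mult_self2)
    ultimately have "(fst p, b) = (fst q, b')"
      using p q b b' by (intro inj_onD[OF inj]) auto
    \<comment> \<open>Equal first components suffice: \<open>snd p\<close> and \<open>snd q\<close> are then both \<open>n - fst p\<close>.\<close>
    thus "p = q" using p q by (auto simp: prod_eq_iff)
  qed
  thus ?thesis using card by (simp add: tiles_cyclic_def)
qed

theorem theorem1p4:
  fixes M :: nat and A B :: "int set"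
  assumes "M > 0"
    and "inj_on (\<lambda>a. a mod int M) A"
    and "inj_on (\<lambda>b. b mod int M) B"
    and "gcd_differences M A \<inter> gcd_differences M B = {}"
  shows "card A * card B \<le> M \<and> (card A * card B = M \<longleftrightarrow> tiles_cyclic M A B)"
proof -
  let ?f = "\<lambda>(a, b). (a + b) mod int M"
  have inj: "inj_on ?f (A \<times> B)"
    using assms by (intro inj_on_sum_mod)
  have sub: "?f ` (A \<times> B) \<subseteq> {0..<int M}"
    using \<open>M > 0\<close> by auto
  have card_sums: "card (?f ` (A \<times> B)) = card A * card B"
    using inj by (simp add: card_image card_cartesian_product)
  have "card A * card B \<le> M"
    using card_mono[OF _ sub] card_sums by simp
  moreover have "tiles_cyclic M A B" if eq: "card A * card B = M"
  proof -
    have "?f ` (A \<times> B) = {0..<int M}"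
      using sub card_sums eq by (intro card_subset_eq) auto
    thus ?thesis
      using inj eq \<open>M > 0\<close> by (intro tiles_cyclic_if_bij_betw) (auto simp: bij_betw_def)
  qed
  moreover have "card A * card B = M" if "tiles_cyclic M A B"
    using that by (simp add: tiles_cyclic_def)
  ultimately show ?thesis by blast
qed

end
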